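(* For all integers $d\ge 1$ and $\delta\ge 1$, $\psi(d,\delta,\lambda)\le(4d^2-2d)\delta-1$, where $\psi$ and $\lambda=\lambda(d,\delta)$ are as defined in the context. Moreover, for $d\ge 2$, this inequality is an equality when $\delta=1$ and is strict when $\delta\ge 2$.
   Context: For integers $d,\delta,p\ge 1$ with $p\ge\delta d$, define $$\psi(d,\delta,p):=\frac{\delta d^2(p-\delta+1)}{p-\delta d+1}+d(p-\delta+1)-1.$$ For $d\ge 2$, put $p_1:=\delta d-1+\lfloor\delta\sqrt{d^2-d}\rfloor$ and $p_2:=p_1+1$ (both are $\ge\delta d$), and define $\lambda:=p_1$ if $\psi(d,\delta,p_1)\le\psi(d,\delta,p_2)$, and $\lambda:=p_2$ if $\psi(d,\delta,p_2)<\psi(d,\delta,p_1)$. For $d=1$, put $\lambda:=\delta$. Thus $\lambda$ depends on $d$ and $\delta$. *)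

theory Defs
  imports Complex_Main
begin

text \<open>
  Only meaningful for \<open>d, \<delta>, p \<ge> 1\<close> and \<open>p \<ge> \<delta> d\<close>; then the denominator is positive. The
  division is that of the reals, not integer division.
\<close>
definition \<psi> :: "int \<Rightarrow> int \<Rightarrow> int \<Rightarrow> real" where
  "\<psi> d \<delta> p =
     of_int (\<delta> * d^2 * (p - \<delta> + 1)) / of_int (p - \<delta> * d + 1) + of_int (d * (p - \<delta> + 1) - 1)"

definition p1 :: "int \<Rightarrow> int \<Rightarrow> int" where
  "p1 d \<delta> = \<delta> * d - 1 + \<lfloor>of_int \<delta> * sqrt (of_int (d^2 - d))\<rfloor>"

definition p2 :: "int \<Rightarrow> int \<Rightarrow> int" where
  "p2 d \<delta> = p1 d \<delta> + 1"

definition lam :: "int \<Rightarrow> int \<Rightarrow> int" where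
  "lam d \<delta> =
     (if d = 1 then \<delta>
      else if \<psi> d \<delta> (p1 d \<delta>) \<le> \<psi> d \<delta> (p2 d \<delta>) then p1 d \<delta> else p2 d \<delta>)"

text \<open>The values at which \<open>\<psi>\<close> is compared lie in its domain:\<close>

lemma p1_p2_ge:
  assumes "d \<ge> 2" "\<delta> \<ge> 1"
  shows "p1 d \<delta> \<ge> \<delta> * d" "p2 d \<delta> \<ge> \<delta> * d"
proof -
  have "d * d \<ge> 2 * d"
    using assms by (intro mult_right_mono) auto
  then have "d^2 - d \<ge> 1"
    using assms unfolding power2_eq_square by linarith
  then have "real_of_int (d^2 - d) \<ge> 1"
    by linarith
  then have "sqrt (of_int (d^2 - d)) \<ge> 1"
    by (rule real_sqrt_ge_one)
  then have "of_int \<delta> * sqrt (of_int (d^2 - d)) \<ge> 1 * 1"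
    using assms by (intro mult_mono) auto
  then have "\<lfloor>of_int \<delta> * sqrt (of_int (d^2 - d))\<rfloor> \<ge> 1"
    by (simp add: le_floor_iff)
  then show "p1 d \<delta> \<ge> \<delta> * d" "p2 d \<delta> \<ge> \<delta> * d"
    by (auto simp: p1_def p2_def)
qed

end

theory Submission
  imports Defs
begin

text \<open>
  Substitute \<open>p = \<delta> d - 1 + x\<close>, so that the denominator of \<open>\<psi>\<close> becomes \<open>x\<close>. Then
  \<open>\<psi> = d (x + \<delta>\<^sup>2 (d\<^sup>2 - d) / x) + \<delta> (2 d\<^sup>2 - d) - 1\<close>, and the amount by which \<open>\<psi>\<close> stays below
  the bound factors as \<open>d (\<delta> d - x) (x - \<delta> (d - 1)) / x\<close> (lemma \<open>psi_gap\<close>). The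
  inequality thus says exactly that \<open>x\<close> lies between \<open>\<delta> (d - 1)\<close> and \<open>\<delta> d\<close>.

  The real minimiser of \<open>\<psi>\<close> is \<open>x = \<delta> \<surd>(d\<^sup>2 - d)\<close>, the geometric mean of these two integers;
  for \<open>d \<ge> 2\<close> its floor \<open>x\<^sub>1\<close> and \<open>x\<^sub>1 + 1\<close> are the two candidates that define \<open>\<lambda>\<close>, and both
  remain in the interval (lemma \<open>floor_geometric_mean_bounds\<close>). The interval has
  length \<open>\<delta>\<close>. For \<open>\<delta> = 1\<close> the candidates are its two endpoints, which gives equality; for
  \<open>\<delta> \<ge> 2\<close> two consecutive integers cannot both be endpoints, so one candidate is interior and
  the smaller of the two values is strictly below the bound.
\<close>

text \<open>
  Clearing the denominator \<open>x\<close> leaves \<open>d\<close> times the quadratic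
  \<open>- x\<^sup>2 + \<delta> (2 d - 1) x - \<delta>\<^sup>2 d (d - 1)\<close>, whose roots have sum \<open>\<delta> d + \<delta> (d - 1)\<close> and
  product \<open>\<delta> d \<cdot> \<delta> (d - 1)\<close>.
\<close>
lemma psi_gap:
  fixes d \<delta> x :: int
  assumes "x > 0"
  shows "of_int ((4 * d^2 - 2 * d) * \<delta> - 1) - \<psi> d \<delta> (\<delta> * d - 1 + x)
    = of_int (d * ((\<delta> * d - x) * (x - \<delta> * (d - 1)))) / of_int x"
  using assms by (simp add: \<psi>_def field_simps power2_eq_square)

text \<open>
  The upper bound is strict because \<open>d\<^sup>2 - d < d\<^sup>2\<close>; since \<open>\<delta> d\<close> is an integer, \<open>x + 1\<close> then
  also stays at or below it, which is what the second candidate for \<open>\<lambda>\<close> requires.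
\<close>
lemma floor_geometric_mean_bounds:
  fixes d \<delta> :: int
  assumes "d \<ge> 1" and "\<delta> \<ge> 1"
  defines "x \<equiv> \<lfloor>of_int \<delta> * sqrt (of_int (d^2 - d))\<rfloor>"
  shows "\<delta> * (d - 1) \<le> x" and "x < \<delta> * d"
proof -
  have "(real_of_int (d - 1))^2 \<le> of_int (d^2 - d)"
    using assms by (simp add: power2_eq_square algebra_simps)
  then have "real_of_int (d - 1) \<le> sqrt (of_int (d^2 - d))"
    by (rule real_le_rsqrt)
  then have "real_of_int (\<delta> * (d - 1)) \<le> of_int \<delta> * sqrt (of_int (d^2 - d))"
    using assms by simp
  then show "\<delta> * (d - 1) \<le> x"
    unfolding x_def by (simp only: le_floor_iff)
  have "sqrt (of_int (d^2 - d)) < real_of_int d"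
    using assms by (intro real_less_lsqrt) auto
  then have "of_int \<delta> * sqrt (of_int (d^2 - d)) < real_of_int (\<delta> * d)"
    using assms by simp
  then show "x < \<delta> * d"
    unfolding x_def by (simp only: floor_less_iff)
qed

lemma psi_lam:
  assumes "d \<ge> 2"
  shows "\<psi> d \<delta> (lam d \<delta>) = min (\<psi> d \<delta> (p1 d \<delta>)) (\<psi> d \<delta> (p2 d \<delta>))"
  using assms by (simp add: lam_def min_def)

theorem mainTheorem5:
  fixes d \<delta> :: int
  assumes "d \<ge> 1" and "\<delta> \<ge> 1"
  shows "\<psi> d \<delta> (lam d \<delta>) \<le> of_int ((4 * d^2 - 2 * d) * \<delta> - 1)
    \<and> (d \<ge> 2 \<longrightarrow>
        (\<delta> = 1 \<longrightarrow> \<psi> d \<delta> (lam d \<delta>) = of_int ((4 * d^2 - 2 * d) * \<delta> - 1))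
      \<and> (\<delta> \<ge> 2 \<longrightarrow> \<psi> d \<delta> (lam d \<delta>) < of_int ((4 * d^2 - 2 * d) * \<delta> - 1)))"
proof (cases "d = 1")
  case True
  then show ?thesis
    using assms by (simp add: lam_def \<psi>_def)
next
  case False
  then have d: "d \<ge> 2"
    using assms by simp
  define x where "x = \<lfloor>of_int \<delta> * sqrt (of_int (d^2 - d))\<rfloor>"
  define B :: real where "B = of_int ((4 * d^2 - 2 * d) * \<delta> - 1)"
  have lower: "\<delta> * (d - 1) \<le> x" and upper: "x < \<delta> * d"
    using floor_geometric_mean_bounds[OF assms] by (simp_all add: x_def)
  have "0 < \<delta> * (d - 1)"
    using d assms by simp
  with lower have pos: "x > 0"
    by linarith
  have p1: "p1 d \<delta> = \<delta> * d - 1 + x" and p2: "p2 d \<delta> = \<delta> * d - 1 + (x + 1)"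
    by (simp_all add: p1_def p2_def x_def)
  have gap1: "B - \<psi> d \<delta> (p1 d \<delta>)
      = of_int (d * ((\<delta> * d - x) * (x - \<delta> * (d - 1)))) / of_int x"
    unfolding B_def p1 using pos by (rule psi_gap)
  have gap2: "B - \<psi> d \<delta> (p2 d \<delta>)
      = of_int (d * ((\<delta> * d - (x + 1)) * (x + 1 - \<delta> * (d - 1)))) / of_int (x + 1)"
    unfolding B_def p2 using pos by (intro psi_gap) simp
  have "0 \<le> B - \<psi> d \<delta> (p1 d \<delta>)"
    unfolding gap1 using lower upper d pos
    by (intro divide_nonneg_pos of_int_nonneg of_int_pos mult_nonneg_nonneg) simp_all
  then have le: "\<psi> d \<delta> (lam d \<delta>) \<le> B"
    by (simp add: psi_lam[OF d])
  moreover have "\<psi> d \<delta> (lam d \<delta>) = B" if "\<delta> = 1"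
  proof -
    have "x = d - 1"
      using that lower upper by simp
    then have "\<psi> d \<delta> (p1 d \<delta>) = B" "\<psi> d \<delta> (p2 d \<delta>) = B"
      using gap1 gap2 that by simp_all
    then show ?thesis
      by (simp add: psi_lam[OF d])
  qed
  moreover have "\<psi> d \<delta> (lam d \<delta>) < B" if "\<delta> \<ge> 2"
  proof (cases "x = \<delta> * (d - 1)")
    case True
    then have "\<delta> * d - (x + 1) = \<delta> - 1" and "x + 1 - \<delta> * (d - 1) = 1"
      by (simp_all add: algebra_simps)
    then have "0 < d * ((\<delta> * d - (x + 1)) * (x + 1 - \<delta> * (d - 1)))"
      using that d by simp
    then have "0 < B - \<psi> d \<delta> (p2 d \<delta>)"
      unfolding gap2 using pos
      by (intro divide_pos_pos of_int_pos) linarith+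
    then show ?thesis
      by (simp add: psi_lam[OF d])
  next
    case False
    then have "0 < d * ((\<delta> * d - x) * (x - \<delta> * (d - 1)))"
      using lower upper d by simp
    then have "0 < B - \<psi> d \<delta> (p1 d \<delta>)"
      unfolding gap1 using pos
      by (intro divide_pos_pos of_int_pos)
    then show ?thesis
      by (simp add: psi_lam[OF d])
  qed
  ultimately show ?thesis
    unfolding B_def by blast
qed

end
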